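(* Let $t\in\{1,\dots,T-1\}$, let $\mathbf{s}=(s_1,\dots,s_N)$ be the vector of cumulative sales before time $t$, let $d_n$ be the remaining inventory of seller $n$ ($n=1,\dots,N$), and let $p$ be the price offered at time $t$. Consider the one-period game $G_t$ in which the players are the sellers $n$ with $d_n\ge 1$, each player's actions are "accept" and "reject", and, if $A$ denotes the set of players who accept, the payoff of player $n$ is $$u_n(A)=\mathbf{1}\{n\in A\}\,\pi_n\,\mathbb{E}_{n,t}\big[p+v_n(t+1,d_n-1,\mathbf{s}+\mathbf{e}_n)\big]+\sum_{j\in A,\,j\neq n}\pi_j\,\mathbb{E}_{n,t}\big[v_n(t+1,d_n,\mathbf{s}+\mathbf{e}_j)\big]+\Big(1-\sum_{j\in A}\pi_j\Big)\mathbb{E}_{n,t}\big[v_n(t+1,d_n,\mathbf{s})\big].$$ Then the strategy profile in which each player $n$ accepts if $$p\ \ge\ \mathbb{E}_{n,t}\big[v_n(t+1,d_n,\mathbf{s})-v_n(t+1,d_n-1,\mathbf{s}+\mathbf{e}_n)\big]$$ and rejects if $$p\ <\ \mathbb{E}_{n,t}\big[v_n(t+1,d_n,\mathbf{s})-v_n(t+1,d_n-1,\mathbf{s}+\mathbf{e}_n)\big]$$ is the unique (pure-strategy) Nash equilibrium of $G_t$.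
   Context: Model. There are $N$ sellers; seller $n$ has initial inventory $C_n$ (a nonnegative integer number of units) of a product. The selling horizon is $t=1,\dots,T$. In each period one unit of demand arrives, with an offered price $P$; prices are i.i.d. over periods with $\Pr[P=p_i]=\theta_i$, $i=1,\dots,I$, the $p_i$ being nonnegative. Each seller with positive remaining inventory accepts or rejects the demand. Selection rule (random selection with static probabilities): fixed probabilities $\pi_1,\dots,\pi_N\ge 0$ with $\sum_{n=1}^N\pi_n=1$ are given; if $A$ is the set of sellers that accept, each $n\in A$ is selected with probability $\pi_n$, and no one is selected with probability $1-\sum_{n\in A}\pi_n$. The selected seller collects the price and loses one unit of inventory. Inventory left after time $T$ has value $0$. Information. $\mathbf{s}=(s_1,\dots,s_N)$ is the vector of units sold so far by each seller (observed by all), $\mathbf{e}_n$ is the $n$-th unit vector, and $d_n=C_n-s_n$ is the remaining inventory of seller $n$, known only to seller $n$. Sellers do not know the competitors' initial inventories but share a common distributional estimate of each $C_m$: any two sellers have the same distribution for a third seller's inventory. $\mathbb{E}_{n,t}$ denotes expectation with respect to the information available to seller $n$ at time $t$, i.e. with each competitor's $C_m$ distributed according to its estimated distribution conditioned on $C_m\ge s_m$. Value functions. $v_n(t,d_n,\mathbf{s})$ is the maximum expected revenue seller $n$ can collect from time $t$ on, with remaining inventory $d_n$ and sales history $\mathbf{s}$, when all sellers follow the equilibrium strategies in each period. It is determined backward by $v_n(T,d_n,\mathbf{s})=\pi_n\mathbb{E}[P]$ for $d_n\ge 1$, $v_n(t,0,\mathbf{s})=0$, and, for $t<T$ and $d_n\ge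 1$, $$v_n(t,d_n,\mathbf{s})=\sum_{i=1}^I\theta_i\,w_n(t+1,d_n,\mathbf{s},p_i),$$ where, with $a_m(p)=\mathbf{1}\{d_m\ge 1 \text{ and } p\ge \mathbb{E}_{m,t}[v_m(t+1,d_m,\mathbf{s})-v_m(t+1,d_m-1,\mathbf{s}+\mathbf{e}_m)]\}$ and $d_m=C_m-s_m$, $$w_n(t+1,d_n,\mathbf{s},p)=\Big(1-\sum_{m=1}^N\pi_m\Big)\mathbb{E}_{n,t}[v_n(t+1,d_n,\mathbf{s})]+\pi_n\Big(a_n(p)\,\mathbb{E}_{n,t}[p+v_n(t+1,d_n-1,\mathbf{s}+\mathbf{e}_n)]+(1-a_n(p))\,\mathbb{E}_{n,t}[v_n(t+1,d_n,\mathbf{s})]\Big)+\sum_{m\ne n}\pi_m\,\mathbb{E}_{n,t}\big[a_m(p)\,v_n(t+1,d_n,\mathbf{s}+\mathbf{e}_m)+(1-a_m(p))\,v_n(t+1,d_n,\mathbf{s})\big].$$ For the game at time $t$, the values $v_n(t+1,\cdot,\cdot)$ are regarded as already computed.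
   Formalization: Uniqueness fails if a player has π_n = 0 or p equals its threshold (it is then indifferent); it is proved when all players have π_n > 0 and indifferent players accept, and every equilibrium is shown to agree with the profile at players with π_n > 0 and p off the threshold. *)

theory Defs
  imports "HOL-Probability.Probability"
begin

text \<open>
  The sellers are the elements of a finite type \<open>'n\<close>, and \<open>'i\<close> indexes the finitely many
  possible prices. The estimate of a seller's initial inventory does not depend on which
  competitor forms it.
\<close>

record ('n, 'i) market =
  horizon :: nat
  sel_prob :: "'n \<Rightarrow> real"
  price :: "'i \<Rightarrow> real"
  price_prob :: "'i \<Rightarrow> real"
  estimate :: "'n \<Rightarrow> nat pmf"

definition add_sale :: "('n \<Rightarrow> nat) \<Rightarrow> 'n \<Rightarrow> 'n \<Rightarrow> nat" where
  "add_sale s n = s(n := s n + 1)"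

text \<open>
  What seller \<open>n\<close>, with \<open>d\<close> units left and sales history \<open>s\<close>, believes about the vector of
  initial inventories: the own one is known, that of any competitor \<open>m\<close> follows its estimate
  conditioned on being at least \<open>s m\<close>. Whether the competitors' inventories are taken to be
  independent is immaterial: no random quantity below depends on more than one of them.
\<close>

definition belief :: "('n::finite, 'i) market \<Rightarrow> 'n \<Rightarrow> nat \<Rightarrow> ('n \<Rightarrow> nat) \<Rightarrow> ('n \<Rightarrow> nat) pmf" where
  "belief M n d s =
     Pi_pmf UNIV 0 (\<lambda>m. if m = n then return_pmf (s n + d) else cond_pmf (estimate M m) {s m..})"

abbreviation expect ::
    "('n::finite, 'i) market \<Rightarrow> 'n \<Rightarrow> nat \<Rightarrow> ('n \<Rightarrow> nat) \<Rightarrow> (('n \<Rightarrow> nat) \<Rightarrow> real) \<Rightarrow> real" where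
  "expect M n d s f \<equiv> measure_pmf.expectation (belief M n d s) f"

text \<open>
  In the next three definitions \<open>V\<close> stands for the value functions \<open>V n d s\<close> of the next period.
\<close>

definition reservation_price ::
    "('n::finite, 'i) market \<Rightarrow> ('n \<Rightarrow> nat \<Rightarrow> ('n \<Rightarrow> nat) \<Rightarrow> real) \<Rightarrow> 'n \<Rightarrow> nat \<Rightarrow> ('n \<Rightarrow> nat) \<Rightarrow> real"
  where
  "reservation_price M V n d s = expect M n d s (\<lambda>_. V n d s - V n (d - 1) (add_sale s n))"

definition acceptance ::
    "('n::finite, 'i) market \<Rightarrow> ('n \<Rightarrow> nat \<Rightarrow> ('n \<Rightarrow> nat) \<Rightarrow> real) \<Rightarrow> 'n \<Rightarrow> nat \<Rightarrow> ('n \<Rightarrow> nat)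
      \<Rightarrow> real \<Rightarrow> real"
  where
  "acceptance M V n d s p = of_bool (1 \<le> d \<and> reservation_price M V n d s \<le> p)"

definition value_given_price ::
    "('n::finite, 'i) market \<Rightarrow> ('n \<Rightarrow> nat \<Rightarrow> ('n \<Rightarrow> nat) \<Rightarrow> real) \<Rightarrow> 'n \<Rightarrow> nat \<Rightarrow> ('n \<Rightarrow> nat)
      \<Rightarrow> real \<Rightarrow> real"
  where
  "value_given_price M V n d s p =
     (1 - (\<Sum>m\<in>UNIV. sel_prob M m)) * expect M n d s (\<lambda>_. V n d s)
     + sel_prob M n *
         (acceptance M V n d s p * expect M n d s (\<lambda>_. p + V n (d - 1) (add_sale s n))
          + (1 - acceptance M V n d s p) * expect M n d s (\<lambda>_. V n d s))
     + (\<Sum>m\<in>UNIV - {n}. sel_prob M m *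
          expect M n d s (\<lambda>C. acceptance M V m (C m - s m) s p * V n d (add_sale s m)
                              + (1 - acceptance M V m (C m - s m) s p) * V n d s))"

text \<open>
  The backward recursion runs over the number of periods remaining after the current one.
\<close>

primrec value_to_go ::
    "('n::finite, 'i::finite) market \<Rightarrow> nat \<Rightarrow> 'n \<Rightarrow> nat \<Rightarrow> ('n \<Rightarrow> nat) \<Rightarrow> real" where
  "value_to_go M 0 = (\<lambda>n d s.
     if d = 0 then 0 else sel_prob M n * (\<Sum>i\<in>UNIV. price_prob M i * price M i))"
| "value_to_go M (Suc k) = (\<lambda>n d s.
     if d = 0 then 0
     else (\<Sum>i\<in>UNIV. price_prob M i * value_given_price M (value_to_go M k) n d s (price M i)))"

definition value_fn ::
    "('n::finite, 'i::finite) market \<Rightarrow> nat \<Rightarrow> 'n \<Rightarrow> nat \<Rightarrow> ('n \<Rightarrow> nat) \<Rightarrow> real" where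
  "value_fn M t = value_to_go M (horizon M - t)"

definition pure_nash ::
    "'n set \<Rightarrow> ('n \<Rightarrow> 'a set) \<Rightarrow> ('n \<Rightarrow> ('n \<Rightarrow> 'a) \<Rightarrow> real) \<Rightarrow> ('n \<Rightarrow> 'a) \<Rightarrow> bool" where
  "pure_nash P S u \<sigma> \<longleftrightarrow>
     \<sigma> \<in> (\<Pi>\<^sub>E n\<in>P. S n) \<and> (\<forall>n\<in>P. \<forall>a\<in>S n. u n (\<sigma>(n := a)) \<le> u n \<sigma>)"

datatype action = Accept | Reject

definition players :: "('n \<Rightarrow> nat) \<Rightarrow> 'n set" where
  "players d = {n. 1 \<le> d n}"

definition payoff ::
    "('n::finite, 'i::finite) market \<Rightarrow> nat \<Rightarrow> ('n \<Rightarrow> nat) \<Rightarrow> ('n \<Rightarrow> nat) \<Rightarrow> real \<Rightarrow> 'n \<Rightarrow> 'n set \<Rightarrow> real"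
  where
  "payoff M t s d p n A =
     of_bool (n \<in> A) * sel_prob M n *
       expect M n (d n) s (\<lambda>_. p + value_fn M (t + 1) n (d n - 1) (add_sale s n))
     + (\<Sum>j\<in>A - {n}. sel_prob M j *
          expect M n (d n) s (\<lambda>_. value_fn M (t + 1) n (d n) (add_sale s j)))
     + (1 - (\<Sum>j\<in>A. sel_prob M j)) *
          expect M n (d n) s (\<lambda>_. value_fn M (t + 1) n (d n) s)"

definition game_nash ::
    "('n::finite, 'i::finite) market \<Rightarrow> nat \<Rightarrow> ('n \<Rightarrow> nat) \<Rightarrow> ('n \<Rightarrow> nat) \<Rightarrow> real
      \<Rightarrow> ('n \<Rightarrow> action) \<Rightarrow> bool"
  where
  "game_nash M t s d p =
     pure_nash (players d) (\<lambda>_. {Accept, Reject})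
       (\<lambda>n \<sigma>. payoff M t s d p n {m \<in> players d. \<sigma> m = Accept})"

definition threshold ::
    "('n::finite, 'i::finite) market \<Rightarrow> nat \<Rightarrow> ('n \<Rightarrow> nat) \<Rightarrow> ('n \<Rightarrow> nat) \<Rightarrow> 'n \<Rightarrow> real" where
  "threshold M t s d n = reservation_price M (value_fn M (t + 1)) n (d n) s"

definition threshold_profile ::
    "('n::finite, 'i::finite) market \<Rightarrow> nat \<Rightarrow> ('n \<Rightarrow> nat) \<Rightarrow> ('n \<Rightarrow> nat) \<Rightarrow> real \<Rightarrow> 'n \<Rightarrow> action"
  where
  "threshold_profile M t s d p =
     (\<lambda>n\<in>players d. if threshold M t s d n \<le> p then Accept else Reject)"

end

theory Submission imports Defs begin

text \<open>
  The next-period values do not depend on the competitors' unknown inventories: every expectation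
  in the payoffs is one of a constant. Fix the set \<open>B\<close> of the other sellers that accept.
  A seller \<open>n\<close> who switches from rejecting to accepting diverts the event of probability
  \<open>\<pi>\<^sub>n\<close> from "nobody is selected" to "\<open>n\<close> is selected"; whether one of the sellers in \<open>B\<close> is
  selected is not affected, because the selection probabilities are static. The gain is therefore
  \<open>\<pi>\<^sub>n\<close> times the difference of the price and the threshold of \<open>n\<close>, whatever \<open>B\<close> is
  (\<open>payoff_insert\<close>).

  Best responses thus do not depend on the opponents, and the equilibrium condition splits into one
  sign condition per player (\<open>game_nash_iff\<close>). The threshold profile satisfies each of them. In
  the other direction, a strictly positive \<open>\<pi>\<^sub>n\<close> and a price off the threshold leave only one
  optimal action; a player with price equal to the threshold, or with \<open>\<pi>\<^sub>n = 0\<close>, is indifferent,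
  and this is why uniqueness needs positive selection probabilities and the tie-breaking rule that
  indifferent players accept.
\<close>

lemma threshold_eq:
  "threshold M t s d n =
     value_fn M (t + 1) n (d n) s - value_fn M (t + 1) n (d n - 1) (add_sale s n)"
  by (simp add: threshold_def reservation_price_def)

text \<open>
  The terms for the other accepting sellers cancel; the weight \<open>\<pi>\<^sub>n\<close> moves from keeping the
  inventory to selling one unit at \<open>p\<close>.
\<close>

lemma payoff_insert:
  assumes "n \<notin> B"
  shows "payoff M t s d p n (insert n B) =
           payoff M t s d p n B + sel_prob M n * (p - threshold M t s d n)"
  using assms by (simp add: payoff_def threshold_eq algebra_simps)

text \<open>
  For a player \<open>n\<close> the opponents' strategies enter the comparison of the two actions only through
  the set of accepting opponents, whose terms cancel; so the condition on \<open>\<sigma>\<close> decouples across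
  players.
\<close>

lemma game_nash_iff:
  "game_nash M t s d p \<sigma> \<longleftrightarrow>
     \<sigma> \<in> extensional (players d) \<and>
     (\<forall>n\<in>players d. if \<sigma> n = Accept then 0 \<le> sel_prob M n * (p - threshold M t s d n)
                    else sel_prob M n * (p - threshold M t s d n) \<le> 0)"
proof -
  have actions: "{Accept, Reject} = UNIV"
    using action.exhaust by auto
  define u where "u n \<tau> = payoff M t s d p n {m \<in> players d. \<tau> m = Accept}" for n \<tau>
  have optimal: "(\<forall>a. u n (\<sigma>(n := a)) \<le> u n \<sigma>) \<longleftrightarrow>
      (if \<sigma> n = Accept then 0 \<le> sel_prob M n * (p - threshold M t s d n)
       else sel_prob M n * (p - threshold M t s d n) \<le> 0)"
    if n: "n \<in> players d" for n
  proof -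
    define B where "B = {m \<in> players d. \<sigma> m = Accept} - {n}"
    have "{m \<in> players d. (\<sigma>(n := Accept)) m = Accept} = insert n B"
      "{m \<in> players d. (\<sigma>(n := Reject)) m = Accept} = B"
      using n by (auto simp: B_def)
    moreover have "n \<notin> B"
      by (simp add: B_def)
    ultimately have gain: "u n (\<sigma>(n := Accept)) =
        u n (\<sigma>(n := Reject)) + sel_prob M n * (p - threshold M t s d n)"
      unfolding u_def by (simp only: payoff_insert not_False_eq_True)
    have two: "(\<forall>a. Q a) \<longleftrightarrow> Q Accept \<and> Q Reject" for Q
      by (metis action.exhaust)
    show ?thesis
    proof (cases "\<sigma> n")
      case Accept
      then have "\<sigma>(n := Accept) = \<sigma>"
        by auto
      with gain Accept show ?thesis
        by (simp add: two)
    next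
      case Reject
      then have "\<sigma>(n := Reject) = \<sigma>"
        by auto
      with gain Reject show ?thesis
        by (simp add: two)
    qed
  qed
  show ?thesis
    unfolding game_nash_def pure_nash_def actions u_def[symmetric]
    by (simp add: optimal PiE_def)
qed

theorem proposition1:
  fixes M :: "('n::finite, 'i::finite) market"
    and C s d :: "'n \<Rightarrow> nat" and t :: nat and p :: real
  assumes "\<forall>n. 0 \<le> sel_prob M n" and "(\<Sum>n\<in>UNIV. sel_prob M n) = 1"
    and "\<forall>i. 0 \<le> price M i"
    and "\<forall>i. 0 \<le> price_prob M i" and "(\<Sum>i\<in>UNIV. price_prob M i) = 1"
    and "1 \<le> t" and "t < horizon M"
    and "\<forall>n. C n = s n + d n"
    and "p \<in> range (price M)"
  shows "game_nash M t s d p (threshold_profile M t s d p)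
    \<and> ((\<forall>n\<in>players d. 0 < sel_prob M n) \<longrightarrow>
         (\<forall>\<sigma>. game_nash M t s d p \<sigma> \<and> (\<forall>n\<in>players d. p = threshold M t s d n \<longrightarrow> \<sigma> n = Accept)
              \<longleftrightarrow> \<sigma> = threshold_profile M t s d p))
    \<and> (\<forall>\<sigma>. game_nash M t s d p \<sigma> \<longrightarrow>
         (\<forall>n\<in>players d. 0 < sel_prob M n \<and> p \<noteq> threshold M t s d n \<longrightarrow>
            \<sigma> n = threshold_profile M t s d p n))"
proof -
  let ?\<tau> = "threshold_profile M t s d p"
  have profile: "?\<tau> n = (if threshold M t s d n \<le> p then Accept else Reject)"
    if "n \<in> players d" for n
    using that by (simp add: threshold_profile_def)
  have ext: "?\<tau> \<in> extensional (players d)"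
    by (simp add: threshold_profile_def)
  have nash: "game_nash M t s d p ?\<tau>"
    unfolding game_nash_iff using assms(1) ext
    by (simp add: profile mult_nonneg_nonpos)
  have forced: "\<sigma> n = ?\<tau> n"
    if "game_nash M t s d p \<sigma>" "n \<in> players d" "0 < sel_prob M n" "p \<noteq> threshold M t s d n" for \<sigma> n
    using that unfolding game_nash_iff
    by (cases "\<sigma> n") (auto simp: profile zero_le_mult_iff mult_le_0_iff split: if_splits)
  have unique: "game_nash M t s d p \<sigma> \<and> (\<forall>n\<in>players d. p = threshold M t s d n \<longrightarrow> \<sigma> n = Accept)
      \<longleftrightarrow> \<sigma> = ?\<tau>" (is "?eq \<sigma> \<longleftrightarrow> _")
    if pos: "\<forall>n\<in>players d. 0 < sel_prob M n" for \<sigma>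
  proof
    assume eq: "?eq \<sigma>"
    show "\<sigma> = ?\<tau>"
    proof (rule extensionalityI)
      show "\<sigma> \<in> extensional (players d)"
        using eq by (simp add: game_nash_iff)
      show "?\<tau> \<in> extensional (players d)"
        by (rule ext)
      show "\<sigma> n = ?\<tau> n" if n: "n \<in> players d" for n
        using eq n pos forced[of \<sigma> n] profile[OF n] by (cases "p = threshold M t s d n") auto
    qed
  next
    assume "\<sigma> = ?\<tau>"
    then show "?eq \<sigma>"
      using nash by (metis profile order_refl)
  qed
  show ?thesis
    using nash unique forced by blast
qed

end
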